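(* There is an absolute constant $C$ such that for every $n$ the following holds. Let $\omega$ be the highest scoring entry to the Busy Beaver contest among all entries of length at most $n$. Then the Kolmogorov complexity of $\omega$ is at least $n-C$. In particular, the length of $\omega$ is at least $n-C$, and $\omega$ is $C$-incompressible.
   Context: Fix a programming language. Busy Beaver contest: a valid entry is a program (algorithm) that halts and outputs a natural number; its score is its output. The Kolmogorov complexity of a finite string $\omega$ is the length of the shortest program that outputs $\omega$. A string is $C$-incompressible if its length is at most $C$ plus its Kolmogorov complexity. *)

theory Defs
  imports Main "HOL-Library.Nat_Bijection" "HOL-Library.Countable"
begin

text \<open>
  Partial recursive functions, with \<open>eval r xs y\<close> meaning that \<open>r\<close> halts on the arguments
  \<open>xs\<close> with value \<open>y\<close>. In \<open>PrimRec f g\<close> the recursion variable is the first argument, and \<open>g\<close>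
  receives the recursion variable, the previous value and the parameters, in this order.
\<close>

datatype recf =
    Zero
  | Succ
  | Proj nat
  | Comp recf "recf list"
  | PrimRec recf recf
  | Mu recf

inductive eval :: "recf \<Rightarrow> nat list \<Rightarrow> nat \<Rightarrow> bool" where
  Zero: "eval Zero xs 0"
| Succ: "eval Succ [x] (Suc x)"
| Proj: "i < length xs \<Longrightarrow> eval (Proj i) xs (xs ! i)"
| Comp: "list_all2 (\<lambda>g y. eval g xs y) gs ys \<Longrightarrow> eval f ys z \<Longrightarrow> eval (Comp f gs) xs z"
| PrimRec_0: "eval f xs y \<Longrightarrow> eval (PrimRec f g) (0 # xs) y"
| PrimRec_Suc: "eval (PrimRec f g) (k # xs) y \<Longrightarrow> eval g (k # y # xs) z
    \<Longrightarrow> eval (PrimRec f g) (Suc k # xs) z"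
| Mu: "eval f (k # xs) 0 \<Longrightarrow> (\<forall>j<k. \<exists>y. eval f (j # xs) (Suc y)) \<Longrightarrow> eval (Mu f) xs k"

text \<open>
  Computability of a partial function between types whose elements are coded by natural numbers.
\<close>

definition partial_computable :: "('b \<Rightarrow> nat) \<Rightarrow> ('c \<Rightarrow> nat) \<Rightarrow> ('b \<Rightarrow> 'c option) \<Rightarrow> bool" where
  "partial_computable cb cc f \<longleftrightarrow>
     (\<exists>r. \<forall>x m. eval r [cb x] m \<longleftrightarrow> (\<exists>y. f x = Some y \<and> m = cc y))"

text \<open>
  Only the letters are numbered by the unspecified injection \<open>to_nat\<close>; as the alphabet is finite,
  computability with respect to the resulting coding of strings does not depend on that choice.
\<close>

definition str_code :: "'a::finite list \<Rightarrow> nat" where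
  "str_code w = list_encode (map to_nat w)"

text \<open>
  A programming language over a finite alphabet: \<open>run p\<close> is the output of the program \<open>p\<close>,
  or \<open>None\<close> if \<open>p\<close> does not halt (or is not a well-formed program). The language is effective,
  and it is universal in the sense used to define Kolmogorov complexity: each computable way of
  describing strings is matched, up to an additive constant in the length of the description.

  Outputs are strings, so the language comes with an effective numeral system: \<open>val y\<close> is the
  number denoted by the string \<open>y\<close>, if any. Several numerals may denote the same number
  (leading zeros, say); \<open>repr\<close> chooses one of them.
\<close>

locale programming_language =
  fixes run :: "'a::finite list \<Rightarrow> 'a list option"
    and val :: "'a list \<Rightarrow> nat option"
    and repr :: "nat \<Rightarrow> 'a list"
  assumes run_computable: "partial_computable str_code str_code run"
    and universal: "\<And>f :: 'a list \<Rightarrow> 'a list option. partial_computable str_code str_code f \<Longrightarrow>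
      \<exists>c. \<forall>x y. f x = Some y \<longrightarrow> (\<exists>p. run p = Some y \<and> length p \<le> length x + c)"
    and val_computable: "partial_computable str_code id val"
    and repr_computable: "partial_computable id str_code (\<lambda>k. Some (repr k))"
    and val_repr: "\<And>k. val (repr k) = Some k"

definition valid_entry :: "('a list \<Rightarrow> 'a list option) \<Rightarrow> ('a list \<Rightarrow> nat option) \<Rightarrow> 'a list \<Rightarrow> bool" where
  "valid_entry run val p \<longleftrightarrow> (\<exists>y k. run p = Some y \<and> val y = Some k)"

definition score :: "('a list \<Rightarrow> 'a list option) \<Rightarrow> ('a list \<Rightarrow> nat option) \<Rightarrow> 'a list \<Rightarrow> nat" where
  "score run val p = the (val (the (run p)))"

definition kolmogorov :: "('a list \<Rightarrow> 'a list option) \<Rightarrow> 'a list \<Rightarrow> nat" where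
  "kolmogorov run w = (LEAST l. \<exists>p. run p = Some w \<and> length p = l)"

definition incompressible :: "('a list \<Rightarrow> 'a list option) \<Rightarrow> nat \<Rightarrow> 'a list \<Rightarrow> bool" where
  "incompressible run C w \<longleftrightarrow> length w \<le> C + kolmogorov run w"

end

theory Submission
  imports Defs
begin

text \<open>
  Let \<open>\<omega>\<close> have the highest score \<open>k\<close> among the entries of length at most \<open>n\<close>. A program of length at
  most \<open>n\<close> for the numeral of \<open>k + 1\<close> would be an entry beating \<open>\<omega>\<close>, so this numeral has complexity
  greater than \<open>n\<close>. But it is computed from \<open>\<omega>\<close> by running \<open>\<omega>\<close> and adding one, and a computable
  map increases Kolmogorov complexity by at most a constant.
\<close>

lemma eval_Proj_iff: "eval (Proj i) xs y \<longleftrightarrow> i < length xs \<and> y = xs ! i"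
  by (auto elim: eval.cases intro: eval.Proj)

lemma eval_Succ_iff: "eval Succ xs y \<longleftrightarrow> (\<exists>x. xs = [x] \<and> y = Suc x)"
  by (auto elim: eval.cases intro: eval.Succ)

lemma eval_Comp_iff:
  "eval (Comp f gs) xs z \<longleftrightarrow> (\<exists>ys. list_all2 (\<lambda>g y. eval g xs y) gs ys \<and> eval f ys z)"
  by (auto elim: eval.cases intro: eval.Comp)

lemma partial_computable_Some: "partial_computable c c Some"
  unfolding partial_computable_def by (intro exI[of _ "Proj 0"]) (simp add: eval_Proj_iff)

lemma partial_computable_Suc: "partial_computable id id (\<lambda>k. Some (Suc k))"
  unfolding partial_computable_def by (intro exI[of _ Succ]) (simp add: eval_Succ_iff)

lemma partial_computable_bind:
  assumes "partial_computable cb cc f" and "partial_computable cc cd g"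
  shows "partial_computable cb cd (\<lambda>x. Option.bind (f x) g)"
proof -
  obtain r where r: "\<And>x m. eval r [cb x] m \<longleftrightarrow> (\<exists>y. f x = Some y \<and> m = cc y)"
    using assms(1) unfolding partial_computable_def by auto
  obtain s where s: "\<And>y m. eval s [cc y] m \<longleftrightarrow> (\<exists>z. g y = Some z \<and> m = cd z)"
    using assms(2) unfolding partial_computable_def by auto
  have "eval (Comp s [r]) [cb x] m \<longleftrightarrow> (\<exists>z. Option.bind (f x) g = Some z \<and> m = cd z)" for x m
    by (cases "f x") (auto simp: eval_Comp_iff list_all2_Cons1 r s)
  then show ?thesis
    unfolding partial_computable_def by blast
qed

lemma kolmogorov_le_length_program: "run p = Some w \<Longrightarrow> kolmogorov run w \<le> length p"
  unfolding kolmogorov_def by (rule Least_le) auto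

lemma ex_program_length_eq_kolmogorov:
  assumes "run p = Some w"
  shows "\<exists>q. run q = Some w \<and> length q = kolmogorov run w"
  unfolding kolmogorov_def by (rule LeastI_ex) (use assms in auto)

context programming_language
begin

lemma ex_program: "\<exists>p. run p = Some w"
  using universal[OF partial_computable_Some] by blast

lemma kolmogorov_le_iff: "kolmogorov run w \<le> n \<longleftrightarrow> (\<exists>p. run p = Some w \<and> length p \<le> n)"
  using ex_program[of w] ex_program_length_eq_kolmogorov[of run _ w]
    kolmogorov_le_length_program[of run _ w]
  by (metis order.trans order.refl)

lemma kolmogorov_le_length_description:
  fixes f :: "'a list \<Rightarrow> 'a list option"
  assumes "partial_computable str_code str_code f"
  shows "\<exists>c. \<forall>x y. f x = Some y \<longrightarrow> kolmogorov run y \<le> length x + c"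
  using universal[OF assms] by (simp add: kolmogorov_le_iff)

lemma kolmogorov_le_length: "\<exists>c. \<forall>w. kolmogorov run w \<le> length w + c"
  using kolmogorov_le_length_description[OF partial_computable_Some] by simp

lemma kolmogorov_computable_image_le:
  fixes f :: "'a list \<Rightarrow> 'a list option"
  assumes "partial_computable str_code str_code f"
  shows "\<exists>c. \<forall>x y. f x = Some y \<longrightarrow> kolmogorov run y \<le> kolmogorov run x + c"
proof -
  have "partial_computable str_code str_code (\<lambda>p. Option.bind (run p) f)"
    using run_computable assms by (rule partial_computable_bind)
  then obtain c
    where c: "\<And>p y. Option.bind (run p) f = Some y \<Longrightarrow> kolmogorov run y \<le> length p + c"
    using kolmogorov_le_length_description by blast
  have "kolmogorov run y \<le> kolmogorov run x + c" if "f x = Some y" for x y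
  proof -
    obtain p where "run p = Some x" and "length p = kolmogorov run x"
      using ex_program ex_program_length_eq_kolmogorov by blast
    then show ?thesis
      using c[of p y] that by simp
  qed
  then show ?thesis
    by blast
qed

lemma kolmogorov_Suc_score_le:
  "\<exists>c. \<forall>p. valid_entry run val p \<longrightarrow>
    kolmogorov run (repr (Suc (score run val p))) \<le> kolmogorov run p + c"
proof -
  define beat where
    "beat p = Option.bind (Option.bind (run p) val) (\<lambda>k. Some (repr (Suc k)))" for p
  have "partial_computable id str_code (\<lambda>k. Some (repr (Suc k)))"
    using partial_computable_bind[OF partial_computable_Suc repr_computable] by simp
  then have "partial_computable str_code str_code beat"
    unfolding beat_def
    by (intro partial_computable_bind[OF partial_computable_bind[OF run_computable val_computable]])
  moreover have "beat p = Some (repr (Suc (score run val p)))" if "valid_entry run val p" for p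
    using that by (auto simp: beat_def valid_entry_def score_def)
  ultimately show ?thesis
    using kolmogorov_computable_image_le by blast
qed

abbreviation busy_beaver :: "nat \<Rightarrow> 'a list \<Rightarrow> bool" where
  "busy_beaver n \<equiv> is_arg_max (score run val) (\<lambda>p. valid_entry run val p \<and> length p \<le> n)"

lemma busy_beaver_less_kolmogorov:
  assumes "busy_beaver n \<omega>" and "val y = Some k" and "score run val \<omega> < k"
  shows "n < kolmogorov run y"
proof (rule ccontr)
  assume "\<not> n < kolmogorov run y"
  then obtain p where "run p = Some y" and "length p \<le> n"
    by (auto simp: not_less kolmogorov_le_iff)
  then have "valid_entry run val p" and "score run val p = k"
    using assms(2) by (auto simp: valid_entry_def score_def)
  then show False
    using assms(1,3) \<open>length p \<le> n\<close> by (auto simp: is_arg_max_def)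
qed

end

theorem theoremE1:
  fixes run :: "'a::finite list \<Rightarrow> 'a list option"
    and val :: "'a list \<Rightarrow> nat option"
    and repr :: "nat \<Rightarrow> 'a list"
  assumes "programming_language run val repr"
  shows "\<exists>C::nat. \<forall>n::nat. \<forall>\<omega>.
    is_arg_max (score run val) (\<lambda>p. valid_entry run val p \<and> length p \<le> n) \<omega> \<longrightarrow>
      int (kolmogorov run \<omega>) \<ge> int n - int C \<and>
      int (length \<omega>) \<ge> int n - int C \<and>
      incompressible run C \<omega>"
proof -
  interpret programming_language run val repr by fact
  obtain a where a: "\<And>w. kolmogorov run w \<le> length w + a"
    using kolmogorov_le_length by blast
  obtain b where b: "\<And>p. valid_entry run val p \<Longrightarrow>
      kolmogorov run (repr (Suc (score run val p))) \<le> kolmogorov run p + b"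
    using kolmogorov_Suc_score_le by blast
  show ?thesis
  proof (intro exI[of _ "a + b"] allI impI)
    fix n \<omega>
    assume max: "busy_beaver n \<omega>"
    then have "valid_entry run val \<omega>" and "length \<omega> \<le> n"
      by (simp_all add: is_arg_max_def)
    moreover have "n < kolmogorov run (repr (Suc (score run val \<omega>)))"
      using max val_repr by (rule busy_beaver_less_kolmogorov) simp
    ultimately show "int (kolmogorov run \<omega>) \<ge> int n - int (a + b) \<and>
        int (length \<omega>) \<ge> int n - int (a + b) \<and> incompressible run (a + b) \<omega>"
      using a[of \<omega>] b[of \<omega>] by (auto simp: incompressible_def)
  qed
qed

end
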